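(* Consider an $s$-stage DIRK method with invertible lower triangular matrix $A=(a_{kj})_{1\le k,j\le s}$, which is stiffly accurate. Then first order accuracy of its f scheme implies first order accuracy of its U scheme, and second order accuracy of its f scheme implies second order accuracy of its U scheme. Explicitly, with $c_k,d_k,C_k,D_k,B_k$ the coefficients defined from $A$ by the recursions in the context: (1) if $c_s=1$, then $C_s=1$; (2) if $c_s=1$ and $d_s=\frac12$, then $C_s=1$, $D_s=\frac12$ and $B_s=0$.
   Context: Stiffly accurate means that the last row of $A$ equals the weight vector, so that the last stage is the update ($f^{n+1}=f^{(s)}$, $U^{n+1}=U^{(s)}$). Set $c_k=\sum_{j=1}^k a_{kj}$. Empty sums are zero. Define, for $1\le j<k\le s$, $$b_{kj} = \frac{a_{kj}}{a_{jj}}-\sum_{l=j+1}^{k-1}\frac{a_{kl}b_{lj}}{a_{ll}}.$$ The f scheme, for $\frac{d}{dt}f=\mathcal{Q}(f)$ (a hyperbolic relaxation or BGK equation $\partial_t f+v\partial_x f=\mathcal{Q}(f)$ written along characteristics), is $f^{(k)}=f^n+\Delta t\sum_{j=1}^{k}a_{kj}\mathcal{Q}(f^{(j)})$, equivalently $f^{(k)}=(1-\sum_{j<k}b_{kj})f^n+\sum_{j<k}b_{kj}f^{(j)}+\Delta t\,a_{kk}\mathcal{Q}(f^{(k)})$. Its Taylor expansion is $f^{(k)}=f^n+c_k\Delta t\,\mathcal{Q}(f^n)+d_k\Delta t^2\mathcal{Q}'(f^n)\mathcal{Q}(f^n)+O(\Delta t^3)$, with $$c_k=\sum_{j=1}^{k-1}b_{kj}c_j+a_{kk},\qquad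 d_k=\sum_{j=1}^{k-1}b_{kj}d_j+a_{kk}c_k .$$ Comparing with the exact solution, its order conditions are: first order: $c_s=1$; second order: additionally $d_s=\frac12$. The U scheme is the limit of the f scheme in the fluid regime, where the collision operator is infinitely stiff and $f$ is replaced by its local equilibrium $M_U[U]$ with moments $U=\langle f\phi\rangle$; here $\phi(v)$ is the vector of collision invariants, $\langle g\rangle$ is integration over $v$, and $\langle M_U[U]\phi\rangle=U$: $$U^{(k)}(x)=\Big(1-\sum_{j=1}^{k-1}b_{kj}\Big)\langle M_U[U^n](x-c_kv\Delta t,v)\phi(v)\rangle+\sum_{j=1}^{k-1}b_{kj}\langle M_U[U^{(j)}](x-(c_k-c_j)v\Delta t,v)\phi(v)\rangle .$$ It approximates $\partial_tU=\mathcal{T}(U):=-\partial_x\langle vM_U[U]\phi\rangle$. With $\mathcal{B}(U):=\frac12\langle v^2\partial_{xx}(M_U[U])\phi\rangle$, its Taylor expansion is $U^{(k)}=U^n+C_k\Delta t\,\mathcal{T}(U^n)+D_k\Delta t^2\mathcal{T}'(U^n)\mathcal{T}(U^n)+B_k\Delta t^2\mathcal{B}(U^n)+O(\Delta t^3)$, where $$C_k=c_k,\quad D_k=\sum_{j=1}^{k-1}b_{kj}\big(D_j+(c_k-c_j)c_j\big),\quad B_k=\Big(1-\sum_{j=1}^{k-1}b_{kj}\Big)c_k^2+\sum_{j=1}^{k-1}b_{kj}\big(B_j+(c_k-c_j)^2\big).$$ Its order conditions are: first order: $C_s=1$; second order: additionally $D_s=\frac12$ and $B_s=0$. "$p$-th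 order accuracy" of a scheme means that its order conditions up to order $p$ hold. *)

theory Defs
  imports Complex_Main "Jordan_Normal_Form.Matrix"
begin

(* Matrix entries are indexed from 0, so stage k of the mathematical text (1 <= k <= s)
   is index k - 1 here: the stages are 0, ..., s - 1, and the last stage is s - 1. *)

definition lower_triangular_mat :: "real mat \<Rightarrow> bool" where
  "lower_triangular_mat A \<longleftrightarrow>
     (\<forall>k < dim_row A. \<forall>j < dim_col A. k < j \<longrightarrow> A $$ (k, j) = 0)"

(* A is the matrix and w the weight vector of the Butcher tableau of an s-stage
   diagonally implicit Runge-Kutta method. *)
definition dirk_method :: "nat \<Rightarrow> real mat \<Rightarrow> real vec \<Rightarrow> bool" where
  "dirk_method s A w \<longleftrightarrow>
     s \<ge> 1 \<and> A \<in> carrier_mat s s \<and> w \<in> carrier_vec s \<and> lower_triangular_mat A"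

definition stiffly_accurate :: "nat \<Rightarrow> real mat \<Rightarrow> real vec \<Rightarrow> bool" where
  "stiffly_accurate s A w \<longleftrightarrow> row A (s - 1) = w"

(* Only the values at j < k are meaningful. *)
function coeff_b :: "real mat \<Rightarrow> nat \<Rightarrow> nat \<Rightarrow> real" where
  "coeff_b A k j = A $$ (k, j) / A $$ (j, j)
     - (\<Sum>l\<in>{j<..<k}. A $$ (k, l) * coeff_b A l j / A $$ (l, l))"
  by pat_completeness auto
termination
  by (relation "Wellfounded.measure (\<lambda>(A, k, j). k)") auto

(* The unconditional recursion equations would make the simplifier loop. *)
declare coeff_b.simps [simp del]

definition coeff_c :: "real mat \<Rightarrow> nat \<Rightarrow> real" where
  "coeff_c A k = (\<Sum>j\<le>k. A $$ (k, j))"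

(* Coefficient of dt^2 Q'(f^n) Q(f^n) in the Taylor expansion of stage k of the f scheme;
   the coefficient of dt Q(f^n) is coeff_c. *)
function coeff_d :: "real mat \<Rightarrow> nat \<Rightarrow> real" where
  "coeff_d A k = (\<Sum>j<k. coeff_b A k j * coeff_d A j) + A $$ (k, k) * coeff_c A k"
  by pat_completeness auto
termination
  by (relation "Wellfounded.measure (\<lambda>(A, k). k)") auto

declare coeff_d.simps [simp del]

(* Coefficients of dt T(U^n), dt^2 T'(U^n) T(U^n) and dt^2 B(U^n) in the Taylor expansion
   of stage k of the U scheme, where T(U) = - d_x <v M_U[U] phi> and
   B(U) = 1/2 <v^2 d_xx (M_U[U]) phi>. *)
definition coeff_C :: "real mat \<Rightarrow> nat \<Rightarrow> real" where
  "coeff_C A k = coeff_c A k"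

function coeff_D :: "real mat \<Rightarrow> nat \<Rightarrow> real" where
  "coeff_D A k =
     (\<Sum>j<k. coeff_b A k j * (coeff_D A j + (coeff_c A k - coeff_c A j) * coeff_c A j))"
  by pat_completeness auto
termination
  by (relation "Wellfounded.measure (\<lambda>(A, k). k)") auto

declare coeff_D.simps [simp del]

function coeff_B :: "real mat \<Rightarrow> nat \<Rightarrow> real" where
  "coeff_B A k =
     (1 - (\<Sum>j<k. coeff_b A k j)) * (coeff_c A k)\<^sup>2
     + (\<Sum>j<k. coeff_b A k j * (coeff_B A j + (coeff_c A k - coeff_c A j)\<^sup>2))"
  by pat_completeness auto
termination
  by (relation "Wellfounded.measure (\<lambda>(A, k). k)") auto

declare coeff_B.simps [simp del]

(* Accuracy of a scheme means that its order conditions hold. They are read off at the last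
   stage, which is the update because the method is stiffly accurate. *)
definition f_first_order :: "nat \<Rightarrow> real mat \<Rightarrow> bool" where
  "f_first_order s A \<longleftrightarrow> coeff_c A (s - 1) = 1"

definition f_second_order :: "nat \<Rightarrow> real mat \<Rightarrow> bool" where
  "f_second_order s A \<longleftrightarrow> coeff_c A (s - 1) = 1 \<and> coeff_d A (s - 1) = 1 / 2"

definition U_first_order :: "nat \<Rightarrow> real mat \<Rightarrow> bool" where
  "U_first_order s A \<longleftrightarrow> coeff_C A (s - 1) = 1"

definition U_second_order :: "nat \<Rightarrow> real mat \<Rightarrow> bool" where
  "U_second_order s A \<longleftrightarrow>
     coeff_C A (s - 1) = 1 \<and> coeff_D A (s - 1) = 1 / 2 \<and> coeff_B A (s - 1) = 0"

end

theory Submission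
  imports Defs "Jordan_Normal_Form.Determinant"
begin

text \<open>Subtracting \<open>f\<^sup>n\<close> and eliminating the collision terms stage by stage turns the Butcher form of the
  scheme into its Shu--Osher form, which for the constant collision term is the recursion
  \<open>c\<^sub>k = \<Sum>\<^sub>j b\<^sub>k\<^sub>j c\<^sub>j + a\<^sub>k\<^sub>k\<close>. Given this recursion, expanding the squares and products in the
  definitions shows that \<open>c\<^sub>k\<^sup>2 - D\<^sub>k\<close> and \<open>(B\<^sub>k + c\<^sub>k\<^sup>2) / 2\<close> both satisfy the recursion of \<open>d\<^sub>k\<close>.
  Hence \<open>D\<^sub>k = c\<^sub>k\<^sup>2 - d\<^sub>k\<close> and \<open>B\<^sub>k = 2 d\<^sub>k - c\<^sub>k\<^sup>2\<close> at every stage.\<close>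

lemma invertible_lower_triangular_diag_nonzero:
  assumes A: "A \<in> carrier_mat n n" and low: "lower_triangular_mat A"
    and inv: "invertible_mat A" and i: "i < n"
  shows "A $$ (i, i) \<noteq> 0"
proof -
  obtain B where AB: "A * B = 1\<^sub>m n" and BA: "B * A = 1\<^sub>m (dim_row B)"
    using inv A unfolding invertible_mat_def inverts_mat_def by auto
  \<comment> \<open>\<open>invertible_mat\<close> leaves the size of \<open>B\<close> open; the
    column counts of \<open>A * B\<close> and \<open>B * A\<close> determine it.\<close>
  have B: "B \<in> carrier_mat n n"
    by (metis A AB BA carrier_matD(2) carrier_matI index_mult_mat(3) index_one_mat(3))
  have "det A * det B = 1"
    using det_mult[OF A B] AB by simp
  moreover have "det A = prod_list (diag_mat A)"
    using low A by (intro det_lower_triangular[OF _ A]) (auto simp: lower_triangular_mat_def)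
  ultimately have "0 \<notin> set (diag_mat A)"
    by (metis prod_list_zero_iff mult_zero_left zero_neq_one)
  moreover have "A $$ (i, i) \<in> set (diag_mat A)"
    using A i by (auto simp: diag_mat_def)
  ultimately show ?thesis by metis
qed

text \<open>Unfolding b once leaves a double sum over j < l < k; collecting it by l isolates the
  residual of each earlier stage.\<close>

lemma coeff_b_weighted_sum:
  "(\<Sum>j<k. coeff_b A k j * f j) =
     (\<Sum>l<k. A $$ (k, l) / A $$ (l, l) * (f l - (\<Sum>j<l. coeff_b A l j * f j)))"
proof -
  let ?g = "\<lambda>l j. A $$ (k, l) * coeff_b A l j / A $$ (l, l) * f j"
  have "(\<Sum>j<k. coeff_b A k j * f j) =
      (\<Sum>j<k. A $$ (k, j) / A $$ (j, j) * f j) - (\<Sum>j<k. \<Sum>l\<in>{j<..<k}. ?g l j)"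
    by (subst coeff_b.simps) (simp add: left_diff_distrib sum_subtractf sum_distrib_right)
  \<comment> \<open>Both sides run over the triangle j < l < k.\<close>
  also have "(\<Sum>j<k. \<Sum>l\<in>{j<..<k}. ?g l j) = (\<Sum>l<k. \<Sum>j<l. ?g l j)"
    by (subst (1 2) sum.Sigma)
      (auto intro!: sum.reindex_bij_witness[where i = prod.swap and j = prod.swap])
  also have "(\<Sum>j<k. A $$ (k, j) / A $$ (j, j) * f j) - \<dots> =
      (\<Sum>l<k. A $$ (k, l) / A $$ (l, l) * (f l - (\<Sum>j<l. coeff_b A l j * f j)))"
    by (simp add: right_diff_distrib sum_subtractf sum_distrib_left mult.assoc)
  finally show ?thesis .
qed

text \<open>By induction the residual of stage l < k is the diagonal entry at l. It cancels the
  denominator in \<open>coeff_b_weighted_sum\<close>, leaving row k without its diagonal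
  entry.\<close>

lemma coeff_c_recursion:
  assumes "\<And>j. j < k \<Longrightarrow> A $$ (j, j) \<noteq> 0"
  shows "coeff_c A k = (\<Sum>j<k. coeff_b A k j * coeff_c A j) + A $$ (k, k)"
  using assms
proof (induction k rule: less_induct)
  case (less k)
  have "coeff_c A l - (\<Sum>j<l. coeff_b A l j * coeff_c A j) = A $$ (l, l)" if "l < k" for l
    using less.IH[OF that] less.prems that by simp
  then have "(\<Sum>j<k. coeff_b A k j * coeff_c A j) = (\<Sum>l<k. A $$ (k, l))"
    using less.prems by (subst coeff_b_weighted_sum) simp
  then show ?case
    by (simp add: coeff_c_def flip: lessThan_Suc_atMost)
qed

lemma coeff_D_eq:
  assumes "\<And>j. j < k \<Longrightarrow> A $$ (j, j) \<noteq> 0"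
  shows "coeff_D A k = (coeff_c A k)\<^sup>2 - coeff_d A k"
  using assms
proof (induction k rule: less_induct)
  case (less k)
  let ?b = "coeff_b A k" and ?c = "coeff_c A"
  have "coeff_D A k = (\<Sum>j<k. ?b j * (((?c j)\<^sup>2 - coeff_d A j) + (?c k - ?c j) * ?c j))"
    using less by (subst coeff_D.simps) simp
  \<comment> \<open>The squares of \<open>?c j\<close> cancel, so only sums governed by the
    recursions of c and d remain.\<close>
  also have "\<dots> = (\<Sum>j<k. ?c k * (?b j * ?c j) - ?b j * coeff_d A j)"
    by (intro sum.cong) (auto simp: algebra_simps power2_eq_square)
  also have "\<dots> = ?c k * (\<Sum>j<k. ?b j * ?c j) - (\<Sum>j<k. ?b j * coeff_d A j)"
    by (simp add: sum_subtractf sum_distrib_left)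
  also have "(\<Sum>j<k. ?b j * ?c j) = ?c k - A $$ (k, k)"
    using coeff_c_recursion[of k A] less.prems by simp
  also have "(\<Sum>j<k. ?b j * coeff_d A j) = coeff_d A k - A $$ (k, k) * ?c k"
    by (simp add: coeff_d.simps[of A k])
  finally show ?case
    by (simp add: algebra_simps power2_eq_square)
qed

lemma coeff_B_eq:
  assumes "\<And>j. j < k \<Longrightarrow> A $$ (j, j) \<noteq> 0"
  shows "coeff_B A k = 2 * coeff_d A k - (coeff_c A k)\<^sup>2"
  using assms
proof (induction k rule: less_induct)
  case (less k)
  let ?b = "coeff_b A k" and ?c = "coeff_c A"
  have "coeff_B A k = (1 - (\<Sum>j<k. ?b j)) * (?c k)\<^sup>2
      + (\<Sum>j<k. ?b j * ((2 * coeff_d A j - (?c j)\<^sup>2) + (?c k - ?c j)\<^sup>2))"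
    using less by (subst coeff_B.simps) simp
  \<comment> \<open>Again the squares of \<open>?c j\<close> cancel; the part with the square of
    \<open>?c k\<close> will complete the weight \<open>1 - (\<Sum>j<k. ?b j)\<close> to 1.\<close>
  also have "(\<Sum>j<k. ?b j * ((2 * coeff_d A j - (?c j)\<^sup>2) + (?c k - ?c j)\<^sup>2)) =
      (\<Sum>j<k. 2 * (?b j * coeff_d A j) - 2 * ?c k * (?b j * ?c j) + ?b j * (?c k)\<^sup>2)"
    by (intro sum.cong) (auto simp: algebra_simps power2_eq_square)
  also have "\<dots> = 2 * (\<Sum>j<k. ?b j * coeff_d A j) - 2 * ?c k * (\<Sum>j<k. ?b j * ?c j)
      + (\<Sum>j<k. ?b j) * (?c k)\<^sup>2"
    by (simp add: sum_subtractf sum.distrib sum_distrib_left sum_distrib_right)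
  also have "(\<Sum>j<k. ?b j * ?c j) = ?c k - A $$ (k, k)"
    using coeff_c_recursion[of k A] less.prems by simp
  also have "(\<Sum>j<k. ?b j * coeff_d A j) = coeff_d A k - A $$ (k, k) * ?c k"
    by (simp add: coeff_d.simps[of A k])
  finally show ?case
    by (simp add: algebra_simps power2_eq_square)
qed

theorem theorem3p4:
  fixes s :: nat and A :: "real mat" and w :: "real vec"
  assumes "dirk_method s A w"
    and "invertible_mat A"
    and "stiffly_accurate s A w"
  shows "(f_first_order s A \<longrightarrow> U_first_order s A) \<and>
         (f_second_order s A \<longrightarrow> U_second_order s A)"
proof -
  have "A $$ (j, j) \<noteq> 0" if "j < s - 1" for j
    using assms(1,2) that invertible_lower_triangular_diag_nonzero[of A s j]
    by (auto simp: dirk_method_def)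
  \<comment> \<open>With c = 1 and d = 1/2 at the last stage, D = 1 - 1/2 and B = 2 * 1/2 -
    1.\<close>
  then show ?thesis
    using coeff_D_eq[of "s - 1" A] coeff_B_eq[of "s - 1" A]
    by (auto simp: f_first_order_def U_first_order_def f_second_order_def U_second_order_def
        coeff_C_def)
qed

end
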